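(* Let $\Omega \subset \mathbb{C}^n$ be an open set. Then $\Omega$ is pseudoconvex if and only if for all $a, b, c \in \mathbb{C}^n$ with $b$ and $c$ linearly independent over $\mathbb{C}$, the open set $$\Omega_h := \{(w_1, w_2) \in \mathbb{C}^2 \mid a + b w_1 + c w_2 \in \Omega\} \subset \mathbb{C}^2$$ (the intersection of $\Omega$ with the complex affine subspace $h = h(a,b,c) = \{a + b w_1 + c w_2 \mid (w_1,w_2) \in \mathbb{C}^2\}$ of complex dimension two, viewed as a set in $\mathbb{C}^2$) is pseudoconvex.
   Context: Pseudoconvexity of an open set in $\mathbb{C}^m$ is meant in the standard sense of several complex variables; no boundary regularity, boundedness or connectedness is assumed. It is characterized by the following Kontinuitätssatz property, which may be taken as the definition: an open set $D \subset \mathbb{C}^m$ is pseudoconvex if, for every family $\{d_\alpha\}_{\alpha \in A}$ of maps from the closed unit disc of $\mathbb{C}$ into $D$ that are continuous on the closed disc and holomorphic on the open disc, whenever the images under all the $d_\alpha$ of the unit circle are contained in a single compact subset of $D$, the images of the whole closed disc under all the $d_\alpha$ are also contained in a single compact subset of $D$. (Equivalently, there exists a holomorphic function on $D$ which cannot be extended holomorphically past any boundary point of $D$.) The empty set is pseudoconvex. *)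

theory Defs
  imports "HOL-Complex_Analysis.Complex_Analysis"
begin

text \<open>A map into \<open>\<complex>\<^sup>m\<close> is holomorphic iff each of its components is
  (\<open>holomorphic_on\<close> itself is only available for scalar-valued functions). The behaviour of
  \<open>d\<close> outside the closed unit disc is irrelevant.\<close>

definition analytic_disc :: "(complex ^ 'm) set \<Rightarrow> (complex \<Rightarrow> complex ^ 'm) \<Rightarrow> bool" where
  "analytic_disc D d \<longleftrightarrow>
     continuous_on (cball 0 1) d \<and>
     (\<forall>i. (\<lambda>z. d z $ i) holomorphic_on ball 0 1) \<and>
     d ` cball 0 1 \<subseteq> D"

text \<open>Kontinuitaetssatz definition of pseudoconvexity. A family of discs enters only through the
  set \<open>F\<close> of its members.\<close>

definition pseudoconvex :: "(complex ^ 'm) set \<Rightarrow> bool" where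
  "pseudoconvex D \<longleftrightarrow>
     open D \<and>
     (\<forall>F. (\<forall>d\<in>F. analytic_disc D d) \<longrightarrow>
        (\<exists>K. compact K \<and> K \<subseteq> D \<and> (\<forall>d\<in>F. d ` sphere 0 1 \<subseteq> K)) \<longrightarrow>
        (\<exists>L. compact L \<and> L \<subseteq> D \<and> (\<forall>d\<in>F. d ` cball 0 1 \<subseteq> L)))"

text \<open>The operation \<open>*s\<close> is complex scalar multiplication (\<open>*\<^sub>R\<close> would be the real one).\<close>

definition plane_section ::
  "(complex ^ 'n) set \<Rightarrow> complex ^ 'n \<Rightarrow> complex ^ 'n \<Rightarrow> complex ^ 'n \<Rightarrow> (complex ^ 2) set" where
  "plane_section \<Omega> a b c = {w. a + (w $ 1) *s b + (w $ 2) *s c \<in> \<Omega>}"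

text \<open>\<open>b \<noteq> c\<close> is needed because \<open>{b, c}\<close> collapses to a singleton when \<open>b = c\<close>.
  \<open>vec\<close> is the vector space structure over the component field, here \<open>\<complex>\<close>.\<close>

definition lin_indep_pair :: "complex ^ 'n \<Rightarrow> complex ^ 'n \<Rightarrow> bool" where
  "lin_indep_pair b c \<longleftrightarrow> b \<noteq> c \<and> vec.independent {b, c}"

end

theory Submission
  imports Defs
begin

text \<open>
  Sections of a pseudoconvex set are pseudoconvex because an affine map \<open>A\<close> turns discs in the
  section into discs in \<open>\<Omega>\<close>: if \<open>L \<subseteq> \<Omega>\<close> is a compact set containing the latter, the former lie in
  the preimage of \<open>L\<close> under \<open>A\<close>, and they are bounded by the maximum modulus principle.

  Conversely, let \<open>\<delta>\<close> be the distance to the complement of \<open>\<Omega>\<close>. By the maximum modulus principle the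
  discs of a family whose boundaries lie in a fixed compact set are uniformly bounded, so it suffices
  that \<open>\<delta> \<circ> d\<close> satisfies the minimum principle on the unit disc for each analytic disc \<open>d\<close> in \<open>\<Omega>\<close>
  (lemma \<open>pseudoconvex_if_infdist_minimum\<close>). If this fails for \<open>d\<close>, then for small \<open>\<epsilon> > 0\<close> the
  function \<open>\<delta>(d z) exp (- \<epsilon> |z|\<^sup>2)\<close> attains its minimum at an interior point \<open>z\<^sub>0\<close>
  (lemma \<open>touching_parameter\<close>). Put \<open>p = d z\<^sub>0\<close>, let \<open>q\<close> be a point of the complement nearest to \<open>p\<close>, and
  put \<open>c = q - p\<close> and \<open>h t = 2 \<epsilon> cnj z\<^sub>0 t\<close>. Minimality says that
  \<open>\<delta>(d (z\<^sub>0 + t)) \<ge> |c| |exp (h t)| exp (\<epsilon> |t|\<^sup>2)\<close>.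
  In dimension at least two there is a complex affine plane through \<open>p\<close> whose directions include \<open>c\<close>
  and \<open>d' z\<^sub>0\<close>. Let \<open>\<mu> t\<close> be the coefficient of \<open>c\<close> in the Hermitian projection of
  \<open>d (z\<^sub>0 + t) - p - t d' z\<^sub>0\<close> onto the line spanned by \<open>c\<close>, and consider in this plane the discs
  \<open>e\<^sub>s t = p + t d' z\<^sub>0 + \<mu> t c + s exp (h t) c\<close> with \<open>0 \<le> s \<le> 1\<close>.
  The difference of \<open>e\<^sub>s t\<close> and \<open>d (z\<^sub>0 + t)\<close> is the sum of \<open>s exp (h t) c\<close> and of a vector that is
  orthogonal to \<open>c\<close> and of size \<open>o(|t|)\<close>. By Pythagoras the orthogonal part changes the square of
  the distance by \<open>o(|t|\<^sup>2)\<close> only, which the factor \<open>exp (\<epsilon> |t|\<^sup>2)\<close> absorbs. So \<open>e\<^sub>s t \<in> \<Omega>\<close> for small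
  \<open>t\<close>, except for \<open>e\<^sub>1 0 = q\<close>. The discs \<open>e\<^sub>s\<close> with \<open>s < 1\<close>, restricted to a small disc
  around \<open>0\<close>, have their boundaries in one compact subset of the section, but their centres converge
  to \<open>q \<notin> \<Omega>\<close>, which contradicts the pseudoconvexity of the section (lemma \<open>infdist_minimum_principle\<close>).

  In dimension one there are no planes and the hypothesis is void, but then the minimum principle for
  \<open>\<delta> \<circ> d\<close> is the maximum modulus principle for the functions \<open>1 / (d z - q)\<close> with \<open>q \<notin> \<Omega>\<close>.
\<close>

section \<open>Bounds for analytic discs\<close>

lemma norm_le_card_bound:
  fixes x :: "complex ^ 'n"
  assumes "\<And>i. norm (x $ i) \<le> B"
  shows "norm x \<le> real CARD('n) * B"
proof -
  have "norm x \<le> (\<Sum>i\<in>UNIV. norm (x $ i))"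
    unfolding norm_vec_def by (rule L2_set_le_sum) simp
  also have "\<dots> \<le> real (card (UNIV :: 'n set)) * B"
    by (rule sum_bounded_above) (use assms in simp)
  finally show ?thesis by simp
qed

lemma max_modulus_disc:
  assumes "continuous_on (cball 0 1) f" "f holomorphic_on ball 0 1"
    and "\<And>z. z \<in> sphere 0 1 \<Longrightarrow> norm (f z) \<le> B" and "z \<in> cball 0 1"
  shows "norm (f z :: complex) \<le> B"
  by (rule maximum_modulus_frontier[of f "cball 0 1"]) (use assms in auto)

text \<open>The factor \<open>CARD('n)\<close> is not sharp; it comes from applying the maximum modulus principle to
  each component separately.\<close>

lemma analytic_disc_bound:
  fixes d :: "complex \<Rightarrow> complex ^ 'n"
  assumes d: "analytic_disc D d" and B: "\<And>z. z \<in> sphere 0 1 \<Longrightarrow> norm (d z) \<le> B"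
    and z: "z \<in> cball 0 1"
  shows "norm (d z) \<le> real CARD('n) * B"
proof (rule norm_le_card_bound)
  fix i
  show "norm (d z $ i) \<le> B"
  proof (rule max_modulus_disc[where f = "\<lambda>z. d z $ i", OF _ _ _ z])
    show "continuous_on (cball 0 1) (\<lambda>z. d z $ i)"
      using d unfolding analytic_disc_def by (auto intro: continuous_intros)
    show "(\<lambda>z. d z $ i) holomorphic_on ball 0 1"
      using d unfolding analytic_disc_def by auto
    show "norm (d w $ i) \<le> B" if "w \<in> sphere 0 1" for w
      using B[OF that] component_le_norm_cart order_trans Finite_Cartesian_Product.norm_nth_le by metis
  qed
qed

section \<open>Sections of pseudoconvex sets\<close>

lemma continuous_on_vec_scale [continuous_intros]:
  fixes f :: "'a::topological_space \<Rightarrow> complex"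
  assumes "continuous_on S f" "continuous_on S g"
  shows "continuous_on S (\<lambda>x. f x *s (g x :: complex ^ 'n))"
  unfolding vector_scalar_mult_def by (intro continuous_intros assms)

text \<open>Linear independence of \<open>b\<close> and \<open>c\<close> plays no role here: the discs in the section are bounded
  without using that the parametrization of the plane is proper.\<close>

lemma pseudoconvex_plane_section:
  fixes \<Omega> :: "(complex ^ 'n) set"
  assumes pc: "pseudoconvex \<Omega>"
  shows "pseudoconvex (plane_section \<Omega> a b c)"
proof -
  define A where "A = (\<lambda>w :: complex ^ 2. a + (w $ 1) *s b + (w $ 2) *s c)"
  have cA: "continuous_on S A" for S
    unfolding A_def by (intro continuous_intros)
  have sec: "plane_section \<Omega> a b c = A -` \<Omega>"
    by (auto simp: plane_section_def A_def)
  have op: "open (A -` \<Omega>)"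
    using pc cA by (auto simp: pseudoconvex_def intro: open_vimage)
  show ?thesis unfolding pseudoconvex_def sec
  proof (intro conjI allI impI op)
    fix F
    assume F: "\<forall>d\<in>F. analytic_disc (A -` \<Omega>) d"
      and "\<exists>K. compact K \<and> K \<subseteq> A -` \<Omega> \<and> (\<forall>d\<in>F. d ` sphere 0 1 \<subseteq> K)"
    then obtain K where K: "compact K" "K \<subseteq> A -` \<Omega>" "\<forall>d\<in>F. d ` sphere 0 1 \<subseteq> K" by blast
    have disc: "\<forall>e\<in>(\<lambda>d. A \<circ> d) ` F. analytic_disc \<Omega> e"
    proof clarify
      fix d assume "d \<in> F"
      then have d: "analytic_disc (A -` \<Omega>) d" using F by blast
      then have "continuous_on (cball 0 1) (A \<circ> d)"
        using continuous_on_compose[OF _ cA] by (auto simp: analytic_disc_def)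
      moreover have "(\<lambda>z. (A \<circ> d) z $ i) holomorphic_on ball 0 1" for i
        using d unfolding A_def analytic_disc_def
        by (auto simp: intro!: holomorphic_intros)
      ultimately show "analytic_disc \<Omega> (A \<circ> d)"
        using d by (auto simp: analytic_disc_def)
    qed
    have "\<exists>K'. compact K' \<and> K' \<subseteq> \<Omega> \<and> (\<forall>e\<in>(\<lambda>d. A \<circ> d) ` F. e ` sphere 0 1 \<subseteq> K')"
      by (rule exI[of _ "A ` K"])
        (use K cA in \<open>auto intro!: compact_continuous_image simp: image_subset_iff\<close>)
    with pc disc obtain L where L: "compact L" "L \<subseteq> \<Omega>"
      "\<forall>e\<in>(\<lambda>d. A \<circ> d) ` F. e ` cball 0 1 \<subseteq> L"
      unfolding pseudoconvex_def by meson
    obtain B where B: "\<And>x. x \<in> K \<Longrightarrow> norm x \<le> B"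
      using compact_imp_bounded[OF K(1)] bounded_iff by blast
    let ?L = "A -` L \<inter> cball 0 (real CARD(2) * B)"
    have "compact ?L"
      using L(1) cA by (intro closed_Int_compact closed_vimage)
        (auto intro: compact_imp_closed)
    moreover have "?L \<subseteq> A -` \<Omega>" using L(2) by auto
    moreover have "d ` cball 0 1 \<subseteq> ?L" if "d \<in> F" for d
    proof clarify
      fix z :: complex assume z: "z \<in> cball 0 1"
      have "norm (d z) \<le> real CARD(2) * B"
        by (rule analytic_disc_bound[of "A -` \<Omega>"])
          (use F K(3) B z that in \<open>auto simp: image_subset_iff simp del: mem_sphere mem_sphere_0\<close>)
      then show "d z \<in> ?L" using L(3) that z by (auto simp: image_subset_iff)
    qed
    ultimately show "\<exists>L. compact L \<and> L \<subseteq> A -` \<Omega> \<and> (\<forall>d\<in>F. d ` cball 0 1 \<subseteq> L)"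
      by (intro exI[of _ ?L] conjI ballI)
  qed
qed

section \<open>The distance to the complement along analytic discs\<close>

lemma mem_if_dist_less_infdist:
  assumes "dist x y < infdist x (- S)"
  shows "y \<in> S"
  using infdist_le[of y "- S" x] assms by force

text \<open>The set \<open>\<Omega> = UNIV\<close> is exempt from the minimum principle because the distance to the empty
  set is \<open>0\<close> by convention.\<close>

lemma pseudoconvex_if_infdist_minimum:
  fixes \<Omega> :: "(complex ^ 'n) set"
  assumes op: "open \<Omega>"
    and min: "\<And>d \<kappa>. \<Omega> \<noteq> UNIV \<Longrightarrow> analytic_disc \<Omega> d \<Longrightarrow>
      \<forall>z\<in>sphere 0 1. \<kappa> \<le> infdist (d z) (- \<Omega>) \<Longrightarrow> \<forall>z\<in>cball 0 1. \<kappa> \<le> infdist (d z) (- \<Omega>)"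
  shows "pseudoconvex \<Omega>"
  unfolding pseudoconvex_def
proof (intro conjI allI impI op)
  fix F
  assume F: "\<forall>d\<in>F. analytic_disc \<Omega> d"
    and "\<exists>K. compact K \<and> K \<subseteq> \<Omega> \<and> (\<forall>d\<in>F. d ` sphere 0 1 \<subseteq> K)"
  then obtain K where K: "compact K" "K \<subseteq> \<Omega>" "\<forall>d\<in>F. d ` sphere 0 1 \<subseteq> K" by blast
  obtain B where "\<And>x. x \<in> K \<Longrightarrow> norm x \<le> B"
    using compact_imp_bounded[OF K(1)] bounded_iff by blast
  then have bd: "norm (d z) \<le> real CARD('n) * B" if "d \<in> F" "z \<in> cball 0 1" for d z
    by (intro analytic_disc_bound[of \<Omega>])
      (use F K(3) that in \<open>auto simp: image_subset_iff simp del: mem_sphere mem_sphere_0\<close>)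
  show "\<exists>L. compact L \<and> L \<subseteq> \<Omega> \<and> (\<forall>d\<in>F. d ` cball 0 1 \<subseteq> L)"
  proof (cases "\<Omega> = UNIV \<or> F = {}")
    case True
    then show ?thesis
    proof
      assume "\<Omega> = UNIV"
      then show ?thesis
        by (intro exI[of _ "cball 0 (real CARD('n) * B)"]) (use bd in auto)
    qed (intro exI[of _ "{}"], simp)
  next
    case False
    then have ne: "- \<Omega> \<noteq> {}" by auto
    have "K \<noteq> {}" using False K(3) by fastforce
    define \<kappa> where "\<kappa> = setdist K (- \<Omega>)"
    have pos: "\<kappa> > 0"
      using setdist_gt_0_compact_closed[OF K(1), of "- \<Omega>"] op ne K(2) \<open>K \<noteq> {}\<close>
      by (auto simp: \<kappa>_def)
    have le: "\<kappa> \<le> infdist x (- \<Omega>)" if "x \<in> K" for x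
      unfolding \<kappa>_def infdist_eq_setdist
      by (rule setdist_subset_left) (use that in auto)
    let ?L = "{x. \<kappa> \<le> infdist x (- \<Omega>)} \<inter> cball 0 (real CARD('n) * B)"
    have "compact ?L"
      by (intro closed_Int_compact closed_Collect_le continuous_intros) auto
    moreover have "?L \<subseteq> \<Omega>"
    proof clarify
      fix x assume "\<kappa> \<le> infdist x (- \<Omega>)"
      with pos show "x \<in> \<Omega>" by (intro mem_if_dist_less_infdist[of x]) auto
    qed
    moreover have "\<forall>d\<in>F. d ` cball 0 1 \<subseteq> ?L"
    proof clarify
      fix d and z :: complex assume *: "d \<in> F" "z \<in> cball 0 1"
      have "\<forall>z\<in>cball 0 1. \<kappa> \<le> infdist (d z) (- \<Omega>)"
        by (rule min) (use False F K(3) le * in auto)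
      then show "d z \<in> ?L" using bd[OF *] * by auto
    qed
    ultimately show ?thesis by (intro exI[of _ ?L] conjI)
  qed
qed

text \<open>If the minimum principle fails for the distance to the complement, it also fails after
  multiplication by \<open>exp (- \<epsilon> |z|\<^sup>2)\<close> with small \<open>\<epsilon>\<close>; an interior minimum of this product is a
  point near which the distance to the complement strictly exceeds the modulus of a nowhere
  vanishing holomorphic function.\<close>

lemma touching_parameter:
  fixes \<Omega> :: "(complex ^ 'n) set" and d :: "complex \<Rightarrow> complex ^ 'n"
  assumes cont: "continuous_on (cball 0 1) d"
    and bdry: "\<forall>z\<in>sphere 0 1. \<kappa> \<le> infdist (d z) (- \<Omega>)"
    and z1: "z1 \<in> cball 0 1" "infdist (d z1) (- \<Omega>) < \<kappa>"
  obtains z0 \<epsilon> where "z0 \<in> ball 0 1" "0 < \<epsilon>"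
    "\<And>z. z \<in> cball 0 1 \<Longrightarrow>
      infdist (d z0) (- \<Omega>) * exp (\<epsilon> * ((norm z)\<^sup>2 - (norm z0)\<^sup>2)) \<le> infdist (d z) (- \<Omega>)"
proof -
  let ?u = "\<lambda>z. infdist (d z) (- \<Omega>)"
  have "((\<lambda>\<epsilon>. \<kappa> * exp (- \<epsilon>)) \<longlongrightarrow> \<kappa> * exp (- 0)) (at_right (0::real))"
    by (intro tendsto_intros)
  then have "eventually (\<lambda>\<epsilon>. ?u z1 < \<kappa> * exp (- \<epsilon>)) (at_right (0::real))"
    using z1(2) by (intro order_tendstoD) auto
  then have "eventually (\<lambda>\<epsilon>. ?u z1 < \<kappa> * exp (- \<epsilon>) \<and> \<epsilon> > 0) (at_right (0::real))"
    by (intro eventually_conj eventually_at_right_less)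
  then obtain \<epsilon> :: real where \<epsilon>: "?u z1 < \<kappa> * exp (- \<epsilon>)" "\<epsilon> > 0"
    using eventually_happens[of _ "at_right (0::real)"] by auto
  let ?f = "\<lambda>z. ?u z * exp (- (\<epsilon> * (norm z)\<^sup>2))"
  have "continuous_on (cball 0 1) ?f"
    by (intro continuous_intros cont)
  then obtain z0 where z0: "z0 \<in> cball 0 1" "\<And>z. z \<in> cball 0 1 \<Longrightarrow> ?f z0 \<le> ?f z"
    using continuous_attains_inf[OF compact_cball, of 0 1 ?f] by auto
  show thesis
  proof (rule that)
    show "z0 \<in> ball 0 1"
    proof (rule ccontr)
      assume "z0 \<notin> ball 0 1"
      then have n: "norm z0 = 1" using z0(1) by auto
      then have "\<kappa> * exp (- \<epsilon>) \<le> ?f z0" using bdry by auto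
      also have "\<dots> \<le> ?f z1" by (rule z0(2)[OF z1(1)])
      also have "\<dots> \<le> ?u z1"
        using \<epsilon>(2) infdist_nonneg[of "d z1" "- \<Omega>"] by (simp add: mult_left_le)
      finally show False using \<epsilon>(1) by simp
    qed
    show "?u z0 * exp (\<epsilon> * ((norm z)\<^sup>2 - (norm z0)\<^sup>2)) \<le> ?u z" if "z \<in> cball 0 1" for z
    proof -
      have "?u z0 * exp (\<epsilon> * ((norm z)\<^sup>2 - (norm z0)\<^sup>2)) = ?f z0 * exp (\<epsilon> * (norm z)\<^sup>2)"
        by (simp add: algebra_simps flip: exp_add)
      also have "\<dots> \<le> ?f z * exp (\<epsilon> * (norm z)\<^sup>2)"
        using z0(2)[OF that] by (intro mult_right_mono) auto
      also have "\<dots> = ?u z" by (simp flip: exp_add)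
      finally show ?thesis .
    qed
  qed fact
qed

section \<open>Complex linear algebra\<close>

lemma lin_indep_pair_span:
  fixes c D :: "complex ^ 'n"
  assumes "c \<noteq> 0" "CARD('n) \<noteq> 1"
  obtains b k l where "lin_indep_pair b c" "D = k *s b + l *s c"
proof -
  have ind: "lin_indep_pair b c" if "\<And>k. b \<noteq> k *s c" for b
  proof -
    have "b \<notin> vec.span {c}" using that by (auto simp: vec.span_singleton)
    then show ?thesis
      using that[of 1] assms(1) unfolding lin_indep_pair_def
      by (auto simp: vec.independent_insert)
  qed
  show thesis
  proof (cases "\<exists>l. D = l *s c")
    case False
    then show thesis using ind[of D] by (intro that[of D 1 0]) auto
  next
    case True
    then obtain l where l: "D = l *s c" by blast
    obtain i where i: "c $ i \<noteq> 0" using assms(1) by (auto simp: vec_eq_iff)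
    have "UNIV \<noteq> {i}" using assms(2) by (metis card_1_singleton_iff One_nat_def)
    then obtain j where "j \<noteq> i" by auto
    then have "axis j 1 \<noteq> k *s c" for k
      using i by (auto simp: vec_eq_iff axis_def dest: spec[of _ i] spec[of _ j])
        (metis mult_eq_0_iff zero_neq_one)
    then show thesis
      using ind l by (intro that[of "axis j 1" 0 l]) auto
  qed
qed

text \<open>The coefficient \<open>\<langle>v, c\<rangle> / |c|\<^sup>2\<close> of the Hermitian orthogonal projection of \<open>v\<close> onto the complex
  line spanned by \<open>c\<close>. The Hermitian product is linear in \<open>v\<close>, so that the coefficient depends
  holomorphically on \<open>v\<close>. For \<open>c = 0\<close> the value is \<open>0\<close>.\<close>

definition herm_coeff :: "complex ^ 'n \<Rightarrow> complex ^ 'n \<Rightarrow> complex" where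
  "herm_coeff c v = (\<Sum>i\<in>UNIV. v $ i * cnj (c $ i)) / of_real ((norm c)\<^sup>2)"

lemma sum_mult_cnj_self: "(\<Sum>i\<in>UNIV. c $ i * cnj (c $ i)) = of_real ((norm (c :: complex ^ 'n))\<^sup>2)"
  by (simp add: norm_vec_def L2_set_def sum_nonneg complex_norm_square[symmetric] del: of_real_power)

text \<open>The real inner product of \<open>complex ^ 'n\<close> is the real part of the Hermitian one, so Hermitian
  orthogonality to \<open>c\<close> is real orthogonality to all complex multiples of \<open>c\<close>.\<close>

lemma herm_coeff_orthogonal:
  fixes c v :: "complex ^ 'n"
  assumes "c \<noteq> 0"
  shows "inner (t *s c) (v - herm_coeff c v *s c) = 0"
proof -
  let ?R = "v - herm_coeff c v *s c"
  have "(\<Sum>i\<in>UNIV. ?R $ i * cnj (c $ i)) =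
      (\<Sum>i\<in>UNIV. v $ i * cnj (c $ i)) - herm_coeff c v * (\<Sum>i\<in>UNIV. c $ i * cnj (c $ i))"
    by (simp add: algebra_simps sum_subtractf sum_distrib_left)
  also have "\<dots> = 0"
    using assms unfolding sum_mult_cnj_self herm_coeff_def by simp
  finally have z: "(\<Sum>i\<in>UNIV. ?R $ i * cnj (c $ i)) = 0" .
  have "inner (t *s c) ?R = inner ?R (t *s c)" by (rule inner_commute)
  also have "\<dots> = Re (\<Sum>i\<in>UNIV. cnj t * (?R $ i * cnj (c $ i)))"
    by (simp add: inner_vec_def inner_complex_def Re_sum algebra_simps)
  also have "\<dots> = 0"
    by (simp only: sum_distrib_left[symmetric] z) simp
  finally show ?thesis .
qed

lemma herm_coeff_pythagoras:
  fixes c v :: "complex ^ 'n"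
  assumes "c \<noteq> 0"
  shows "(norm (t *s c - (v - herm_coeff c v *s c)))\<^sup>2 \<le> (norm t)\<^sup>2 * (norm c)\<^sup>2 + (norm v)\<^sup>2"
proof -
  let ?R = "v - herm_coeff c v *s c"
  have o: "inner (t *s c) ?R = 0" for t by (rule herm_coeff_orthogonal[OF assms])
  have pyth: "(norm (x - y))\<^sup>2 = (norm x)\<^sup>2 + (norm y)\<^sup>2" if "inner x y = 0" for x y :: "complex ^ 'n"
    using that by (simp add: power2_norm_eq_inner inner_diff_left inner_diff_right inner_commute)
  have sc: "(norm (t *s c))\<^sup>2 = (norm t)\<^sup>2 * (norm c)\<^sup>2"
    by (simp add: norm_vec_def L2_set_def sum_nonneg power_mult_distrib norm_mult sum_distrib_left)
  have "(norm v)\<^sup>2 = (norm (herm_coeff c v *s c + ?R))\<^sup>2" by simp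
  also have "\<dots> = (norm (herm_coeff c v *s c))\<^sup>2 + (norm ?R)\<^sup>2"
    using o[of "herm_coeff c v"] by (intro norm_add_Pythagorean) (simp add: orthogonal_def)
  finally have "(norm ?R)\<^sup>2 \<le> (norm v)\<^sup>2" by simp
  moreover have "(norm (t *s c - ?R))\<^sup>2 = (norm (t *s c))\<^sup>2 + (norm ?R)\<^sup>2"
    using pyth[OF o] .
  ultimately show ?thesis using sc by simp
qed

section \<open>Discs in a two-dimensional plane\<close>

text \<open>The witness \<open>D\<close> is the derivative of \<open>d\<close> at \<open>z0\<close>.\<close>

lemma first_order_approximation:
  fixes d :: "complex \<Rightarrow> complex ^ 'n"
  assumes hol: "\<And>i. (\<lambda>z. d z $ i) holomorphic_on ball 0 1" and z0: "z0 \<in> ball 0 1" and "\<eta> > 0"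
  obtains r D where "0 < r" "r \<le> 1" "cball z0 r \<subseteq> ball 0 1"
    "\<And>t. norm t \<le> r \<Longrightarrow> norm (d (z0 + t) - d z0 - t *s D) \<le> \<eta> * norm t"
proof -
  define D where "D = (\<chi> i. deriv (\<lambda>z. d z $ i) z0)"
  define \<eta>' where "\<eta>' = \<eta> / real CARD('n)"
  have "\<eta>' > 0" using assms(3) by (simp add: \<eta>'_def)
  have "\<forall>\<^sub>F z in nhds z0. norm (d z $ i - d z0 $ i - D $ i * (z - z0)) \<le> \<eta>' * norm (z - z0)" for i
  proof -
    have "((\<lambda>z. d z $ i) has_field_derivative D $ i) (at z0)"
      using holomorphic_derivI[OF hol _ z0] by (simp add: D_def)
    then have "((\<lambda>z. d z $ i) has_derivative (*) (D $ i)) (at z0)"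
      by (simp add: has_field_derivative_def)
    then obtain \<delta> where "\<delta> > 0"
      "\<And>z. norm (z - z0) < \<delta> \<Longrightarrow> norm (d z $ i - d z0 $ i - D $ i * (z - z0)) \<le> \<eta>' * norm (z - z0)"
      using \<open>\<eta>' > 0\<close> unfolding has_derivative_at_alt by meson
    then show ?thesis
      unfolding eventually_nhds_metric by (auto simp: dist_norm)
  qed
  then have "\<forall>\<^sub>F z in nhds z0. \<forall>i. norm (d z $ i - d z0 $ i - D $ i * (z - z0)) \<le> \<eta>' * norm (z - z0)"
    by (intro eventually_all_finite) auto
  moreover have "\<forall>\<^sub>F z in nhds z0. z \<in> ball 0 1"
    using z0 by (intro eventually_nhds_in_open) auto
  ultimately have "\<forall>\<^sub>F z in nhds z0. z \<in> ball 0 1 \<and>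
      (\<forall>i. norm (d z $ i - d z0 $ i - D $ i * (z - z0)) \<le> \<eta>' * norm (z - z0))"
    by eventually_elim auto
  then obtain e where e: "e > 0" "\<And>z. dist z z0 < e \<Longrightarrow> z \<in> ball 0 1 \<and>
      (\<forall>i. norm (d z $ i - d z0 $ i - D $ i * (z - z0)) \<le> \<eta>' * norm (z - z0))"
    unfolding eventually_nhds_metric by blast
  show thesis
  proof (rule that[of "min 1 (e / 2)" D])
    show "cball z0 (min 1 (e / 2)) \<subseteq> ball 0 1"
      using e by (auto simp: dist_commute)
    fix t :: complex assume t: "norm t \<le> min 1 (e / 2)"
    then have "norm ((d (z0 + t) - d z0 - t *s D) $ i) \<le> \<eta>' * norm t" for i
      using e(1) conjunct2[OF e(2)[of "z0 + t"]] by (auto simp: dist_norm mult.commute)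
    then have "norm (d (z0 + t) - d z0 - t *s D) \<le> real CARD('n) * (\<eta>' * norm t)"
      by (rule norm_le_card_bound)
    then show "norm (d (z0 + t) - d z0 - t *s D) \<le> \<eta> * norm t"
      by (simp add: \<eta>'_def)
  qed (use e(1) in auto)
qed

text \<open>The central step: the discs \<open>e s\<close> are given in the coordinates of the plane through \<open>p\<close> with
  directions \<open>b\<close> and \<open>c\<close>, which contains the tangent direction \<open>D\<close> of \<open>d\<close> at \<open>z0\<close>.\<close>

lemma infdist_minimum_principle:
  fixes \<Omega> :: "(complex ^ 'n) set"
  assumes op: "open \<Omega>" and card: "CARD('n) \<noteq> 1"
    and sec: "\<And>a b c. lin_indep_pair b c \<Longrightarrow> pseudoconvex (plane_section \<Omega> a b c)"
    and ne: "\<Omega> \<noteq> UNIV" and d: "analytic_disc \<Omega> d"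
    and bdry: "\<forall>z\<in>sphere 0 1. \<kappa> \<le> infdist (d z) (- \<Omega>)"
  shows "\<forall>z\<in>cball 0 1. \<kappa> \<le> infdist (d z) (- \<Omega>)"
proof (rule ccontr)
  assume "\<not> ?thesis"
  then obtain z1 where z1: "z1 \<in> cball 0 1" "infdist (d z1) (- \<Omega>) < \<kappa>" by force
  have cont: "continuous_on (cball 0 1) d" and dsub: "d ` cball 0 1 \<subseteq> \<Omega>"
    and hol: "\<And>i. (\<lambda>z. d z $ i) holomorphic_on ball 0 1"
    using d by (auto simp: analytic_disc_def)
  obtain z0 \<epsilon> where z0: "z0 \<in> ball 0 1" and \<epsilon>: "0 < \<epsilon>" and
    touch: "\<And>z. z \<in> cball 0 1 \<Longrightarrow>
      infdist (d z0) (- \<Omega>) * exp (\<epsilon> * ((norm z)\<^sup>2 - (norm z0)\<^sup>2)) \<le> infdist (d z) (- \<Omega>)"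
    using touching_parameter[OF cont bdry z1] by blast
  define p where "p = d z0"
  have "closed (- \<Omega>)" "- \<Omega> \<noteq> {}" using op ne by auto
  then obtain q where q: "q \<in> - \<Omega>" "infdist p (- \<Omega>) = dist p q"
    using infdist_attains_inf by metis
  have "p \<in> \<Omega>" using dsub z0 by (auto simp: p_def)
  define c where "c = q - p"
  have c: "c \<noteq> 0" using q \<open>p \<in> \<Omega>\<close> by (auto simp: c_def)
  have normc: "infdist p (- \<Omega>) = norm c"
    using q by (simp add: c_def dist_norm norm_minus_commute)
  define h where "h t = 2 * of_real \<epsilon> * cnj z0 * t" for t :: complex
  have Re_h: "\<epsilon> * ((norm (z0 + t))\<^sup>2 - (norm z0)\<^sup>2) = Re (h t) + \<epsilon> * (norm t)\<^sup>2" for t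
    unfolding h_def cmod_power2 by (simp add: power2_eq_square algebra_simps)
  have h_lower: "exp (- 2 * \<epsilon>) \<le> norm (exp (h t))" if "norm t \<le> 1" for t
  proof -
    have "norm (h t) \<le> 2 * \<epsilon>"
      using \<epsilon> z0 that mult_le_one[of "norm z0" "norm t"]
      by (simp add: h_def norm_mult mult.assoc)
    then have "- (2 * \<epsilon>) \<le> Re (h t)"
      using abs_Re_le_cmod[of "h t"] by linarith
    then show ?thesis by simp
  qed
  \<comment> \<open>Chosen so that \<open>(\<eta> |t|)\<^sup>2 \<le> |c|\<^sup>2 |exp (h t)|\<^sup>2 \<epsilon> |t|\<^sup>2\<close>, which is half of the first-order gain
    from the factor \<open>exp (2 \<epsilon> |t|\<^sup>2)\<close> in the square of the distance.\<close>
  define \<eta> where "\<eta> = norm c * exp (- 2 * \<epsilon>) * sqrt \<epsilon>"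
  have "\<eta> > 0" using c \<epsilon> by (simp add: \<eta>_def)
  obtain r D where r: "0 < r" "r \<le> 1" "cball z0 r \<subseteq> ball 0 1" and
    D: "\<And>t. norm t \<le> r \<Longrightarrow> norm (d (z0 + t) - d z0 - t *s D) \<le> \<eta> * norm t"
    using first_order_approximation[OF hol z0 \<open>\<eta> > 0\<close>] by blast
  obtain b k l where indep: "lin_indep_pair b c" and Dbc: "D = k *s b + l *s c"
    using lin_indep_pair_span[OF c card] by blast
  define v where "v t = d (z0 + t) - p - t *s D" for t
  define \<mu> where "\<mu> t = herm_coeff c (v t)" for t
  define e where "e s t = (\<chi> i::2. if i = 1 then k * t
      else l * t + \<mu> t + of_real s * exp (h t))" for s :: real and t
  let ?P = "plane_section \<Omega> p b c"
  have e_point: "p + (e s t $ 1) *s b + (e s t $ 2) *s c =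
      p + t *s D + \<mu> t *s c + (of_real s * exp (h t)) *s c" for s t
    by (simp add: e_def Dbc vec_eq_iff algebra_simps)
  have inside: "e s t \<in> ?P" if t: "norm t \<le> r" "t \<noteq> 0" and s: "0 \<le> s" "s \<le> 1" for s t
  proof -
    let ?y = "p + t *s D + \<mu> t *s c + (of_real s * exp (h t)) *s c"
    let ?E = "(norm (exp (h t)))\<^sup>2"
    have n0: "z0 + t \<in> cball 0 1"
    proof -
      have "z0 + t \<in> cball z0 r" using t by (simp add: dist_norm)
      then show ?thesis using r(3) ball_subset_cball by blast
    qed
    have "dist (d (z0 + t)) ?y =
        norm ((of_real s * exp (h t)) *s c - (v t - herm_coeff c (v t) *s c))"
      unfolding dist_norm by (subst norm_minus_commute) (simp add: v_def \<mu>_def algebra_simps)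
    then have "(dist (d (z0 + t)) ?y)\<^sup>2 \<le>
        (norm (of_real s * exp (h t)))\<^sup>2 * (norm c)\<^sup>2 + (norm (v t))\<^sup>2"
      using herm_coeff_pythagoras[OF c] by metis
    also have "(norm (of_real s * exp (h t)))\<^sup>2 = s\<^sup>2 * ?E"
      by (simp add: norm_mult power_mult_distrib)
    also have "s\<^sup>2 * ?E * (norm c)\<^sup>2 \<le> 1 * ?E * (norm c)\<^sup>2"
      using s by (intro mult_right_mono) (auto simp: power_le_one)
    also have "(norm (v t))\<^sup>2 \<le> (norm c)\<^sup>2 * ?E * (\<epsilon> * (norm t)\<^sup>2)"
    proof -
      have "(norm (v t))\<^sup>2 \<le> (\<eta> * norm t)\<^sup>2"
        using D[OF t(1)] by (intro power_mono) (auto simp: v_def p_def)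
      also have "\<dots> = (norm c)\<^sup>2 * (exp (- 2 * \<epsilon>))\<^sup>2 * (\<epsilon> * (norm t)\<^sup>2)"
        using \<epsilon> by (simp add: \<eta>_def power_mult_distrib)
      also have "\<dots> \<le> (norm c)\<^sup>2 * ?E * (\<epsilon> * (norm t)\<^sup>2)"
        using \<epsilon> h_lower[of t] t(1) r(2)
        by (intro mult_right_mono mult_left_mono power_mono) auto
      finally show ?thesis .
    qed
    also have "1 * ?E * (norm c)\<^sup>2 + (norm c)\<^sup>2 * ?E * (\<epsilon> * (norm t)\<^sup>2) =
        (norm c)\<^sup>2 * ?E * (1 + \<epsilon> * (norm t)\<^sup>2)"
      by (simp add: algebra_simps)
    also have "\<dots> < (norm c)\<^sup>2 * ?E * exp (2 * (\<epsilon> * (norm t)\<^sup>2))"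
    proof (intro mult_strict_left_mono)
      have "0 < \<epsilon> * (norm t)\<^sup>2" using \<epsilon> t(2) by simp
      then show "1 + \<epsilon> * (norm t)\<^sup>2 < exp (2 * (\<epsilon> * (norm t)\<^sup>2))"
        using exp_ge_add_one_self[of "2 * (\<epsilon> * (norm t)\<^sup>2)"] by linarith
    qed (use c in simp)
    also have "\<dots> = (norm c * exp (Re (h t) + \<epsilon> * (norm t)\<^sup>2))\<^sup>2"
      by (simp add: power_mult_distrib exp_add exp_double)
    finally have "(dist (d (z0 + t)) ?y)\<^sup>2 < (norm c * exp (Re (h t) + \<epsilon> * (norm t)\<^sup>2))\<^sup>2"
      by simp
    then have "dist (d (z0 + t)) ?y < norm c * exp (Re (h t) + \<epsilon> * (norm t)\<^sup>2)"
      by (rule power2_less_imp_less) simp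
    also have "\<dots> \<le> infdist (d (z0 + t)) (- \<Omega>)"
      using touch[OF n0] normc by (simp add: Re_h p_def)
    finally have "?y \<in> \<Omega>" by (rule mem_if_dist_less_infdist)
    then show ?thesis by (simp add: plane_section_def e_point)
  qed
  have v0: "\<mu> 0 = 0" "h 0 = 0"
    by (auto simp: \<mu>_def v_def p_def herm_coeff_def h_def)
  \<comment> \<open>At the centre the disc lies on the segment from \<open>p\<close> to its nearest point \<open>q\<close>.\<close>
  have centre: "e s 0 \<in> ?P" if s: "0 \<le> s" "s < 1" for s
  proof -
    have "p + s *\<^sub>R c \<in> \<Omega>"
      by (rule mem_if_dist_less_infdist[of p]) (use s c normc in \<open>simp add: dist_norm\<close>)
    also have "p + s *\<^sub>R c = p + (e s 0 $ 1) *s b + (e s 0 $ 2) *s c"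
      by (simp add: e_point v0 vec_eq_iff scaleR_conv_of_real[symmetric])
    finally show ?thesis by (simp add: plane_section_def)
  qed
  have d_comp: "(\<lambda>t. d (z0 + of_real r * t) $ i) holomorphic_on ball 0 1"
    and shift: "(\<lambda>t. z0 + of_real r * t) ` cball 0 1 \<subseteq> ball 0 1" for i
  proof -
    have "z0 + of_real r * t \<in> ball 0 1" if "norm t \<le> 1" for t
    proof -
      have "z0 + of_real r * t \<in> cball z0 r"
        using that r(1) by (simp add: dist_norm norm_mult mult_left_le)
      then show ?thesis using r(3) by blast
    qed
    then show "(\<lambda>t. z0 + of_real r * t) ` cball 0 1 \<subseteq> ball 0 1" by auto
    then have "(\<lambda>t. z0 + of_real r * t) ` ball 0 1 \<subseteq> ball 0 1"
      using ball_subset_cball by blast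
    then show "(\<lambda>t. d (z0 + of_real r * t) $ i) holomorphic_on ball 0 1"
      by (intro holomorphic_on_compose_gen[OF _ hol, unfolded o_def] holomorphic_intros)
  qed
  have d_cont: "continuous_on (cball 0 1) (\<lambda>t. d (z0 + of_real r * t))"
    by (rule continuous_on_compose2[OF cont])
      (use shift in \<open>auto intro!: continuous_intros\<close>)
  have \<mu>_cont: "continuous_on (cball 0 1) (\<lambda>t. \<mu> (of_real r * t))"
    unfolding \<mu>_def herm_coeff_def v_def using c
    by (auto intro!: continuous_intros d_cont)
  have \<mu>_hol: "(\<lambda>t. \<mu> (of_real r * t)) holomorphic_on ball 0 1"
    unfolding \<mu>_def herm_coeff_def v_def using c
    by (auto intro!: holomorphic_intros d_comp)
  \<comment> \<open>The discs rescaled to the unit disc, as a function of the pair of \<open>t\<close> and \<open>s\<close>, so that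
    compactness in both parameters can be used.\<close>
  define G where "G x = e (snd x) (of_real r * fst x)" for x
  have G_cont: "continuous_on (cball 0 1 \<times> UNIV) G"
  proof -
    have "continuous_on (cball 0 1 \<times> UNIV) (\<lambda>x :: complex \<times> real. \<mu> (of_real r * fst x))"
      by (rule continuous_on_compose2[OF \<mu>_cont]) (auto intro!: continuous_intros)
    then have "continuous_on (cball 0 1 \<times> UNIV) (\<lambda>x. G x $ i)" for i
      unfolding G_def e_def h_def by (cases "i = 1") (auto intro!: continuous_intros)
    then show ?thesis
      using continuous_on_vec_lambda[of "cball 0 1 \<times> UNIV" "\<lambda>i x. G x $ i"] by simp
  qed
  define F where "F = (\<lambda>s t. G (t, s)) ` {0..<1}"
  have "\<forall>f\<in>F. analytic_disc ?P f"
    unfolding F_def analytic_disc_def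
  proof (intro ballI conjI; clarify)
    fix s :: real assume s: "s \<in> {0..<1}"
    show "continuous_on (cball 0 1) (\<lambda>t. G (t, s))"
      by (rule continuous_on_compose2[OF G_cont]) (auto intro!: continuous_intros)
    show "(\<lambda>t. G (t, s) $ i) holomorphic_on ball 0 1" for i
      using \<mu>_hol unfolding G_def e_def h_def
      by (cases "i = 1") (auto intro!: holomorphic_intros)
    fix t :: complex assume "t \<in> cball 0 1"
    then show "G (t, s) \<in> ?P"
      using s inside[of "of_real r * t" s] centre[of s] r(1)
      by (cases "t = 0") (auto simp: G_def norm_mult mult_left_le)
  qed
  moreover have "\<exists>K. compact K \<and> K \<subseteq> ?P \<and> (\<forall>f\<in>F. f ` sphere 0 1 \<subseteq> K)"
  proof (rule exI[of _ "G ` (sphere 0 1 \<times> {0..1})"], intro conjI)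
    show "compact (G ` (sphere 0 1 \<times> {0..1}))"
      by (intro compact_continuous_image continuous_on_subset[OF G_cont] compact_Times) auto
    show "G ` (sphere 0 1 \<times> {0..1}) \<subseteq> ?P"
      using r(1) by (auto simp: G_def norm_mult intro!: inside)
    show "\<forall>f\<in>F. f ` sphere 0 1 \<subseteq> G ` (sphere 0 1 \<times> {0..1})"
      by (auto simp: F_def)
  qed
  ultimately obtain L where L: "compact L" "L \<subseteq> ?P" "\<forall>f\<in>F. f ` cball 0 1 \<subseteq> L"
    using sec[OF indep, of p] unfolding pseudoconvex_def by meson
  \<comment> \<open>The centres lie in the compact set \<open>L\<close> for \<open>s < 1\<close>, hence also for \<open>s = 1\<close>.\<close>
  have "continuous_on UNIV (\<lambda>s. G (0, s))"
    by (rule continuous_on_compose2[OF G_cont]) (auto intro!: continuous_intros)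
  then have "closed ((\<lambda>s. G (0, s)) -` L)"
    using L(1) by (intro closed_vimage) (auto intro: compact_imp_closed)
  moreover have "{0..<1} \<subseteq> (\<lambda>s. G (0, s)) -` L"
    using L(3) by (auto simp: F_def image_subset_iff)
  ultimately have "closure {0..<1} \<subseteq> (\<lambda>s. G (0, s)) -` L"
    by (intro closure_minimal)
  then have "{0..1} \<subseteq> (\<lambda>s. G (0, s)) -` L" by simp
  then have "G (0, 1) \<in> ?P" using L(2) by (meson atLeastAtMost_iff order_refl subsetD vimageE zero_le_one)
  then have "p + c \<in> \<Omega>"
    unfolding plane_section_def G_def mem_Collect_eq e_point by (simp add: v0)
  then show False using q(1) by (simp add: c_def)
qed

section \<open>Dimension one\<close>

lemma infdist_minimum_principle_dim_1:
  fixes \<Omega> :: "(complex ^ 'n) set"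
  assumes op: "open \<Omega>" and card: "CARD('n) = 1" and ne: "\<Omega> \<noteq> UNIV" and d: "analytic_disc \<Omega> d"
    and bdry: "\<forall>z\<in>sphere 0 1. \<kappa> \<le> infdist (d z) (- \<Omega>)"
  shows "\<forall>z\<in>cball 0 1. \<kappa> \<le> infdist (d z) (- \<Omega>)"
proof (cases "\<kappa> > 0")
  case False
  then show ?thesis using infdist_nonneg order_trans by (metis linorder_not_less)
next
  case True
  obtain i :: 'n where i: "UNIV = {i}" using card card_1_singletonE by metis
  have norm_eq: "norm x = norm (x $ i)" for x :: "complex ^ 'n"
    by (simp add: norm_vec_def i)
  show ?thesis
  proof
    fix z :: complex assume z: "z \<in> cball 0 1"
    have "\<kappa> \<le> dist (d z) q" if q: "q \<in> - \<Omega>" for q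
    proof -
      have nz: "d w $ i - q $ i \<noteq> 0" if "w \<in> cball 0 1" for w
      proof
        assume "d w $ i - q $ i = 0"
        then have "norm (d w - q) = 0" using norm_eq[of "d w - q"] by simp
        then show False using d q that by (auto simp: analytic_disc_def image_subset_iff)
      qed
      have "norm (inverse (d z $ i - q $ i)) \<le> inverse \<kappa>"
      proof (rule max_modulus_disc[where f = "\<lambda>z. inverse (d z $ i - q $ i)", OF _ _ _ z])
        show "continuous_on (cball 0 1) (\<lambda>z. inverse (d z $ i - q $ i))"
          using d nz by (auto simp: analytic_disc_def intro!: continuous_intros)
        show "(\<lambda>z. inverse (d z $ i - q $ i)) holomorphic_on ball 0 1"
          using d nz by (auto simp: analytic_disc_def intro!: holomorphic_intros)
        fix w :: complex assume "w \<in> sphere 0 1"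
        then have "\<kappa> \<le> dist (d w) q"
          using bdry infdist_le[OF q, of "d w"] by force
        then show "norm (inverse (d w $ i - q $ i)) \<le> inverse \<kappa>"
          using True norm_eq[of "d w - q"] by (simp add: norm_inverse dist_norm le_imp_inverse_le)
      qed
      then show ?thesis
        using True nz[OF z] norm_eq[of "d z - q"] by (simp add: norm_inverse dist_norm)
    qed
    then show "\<kappa> \<le> infdist (d z) (- \<Omega>)"
      using ne by (auto simp: infdist_def intro!: cINF_greatest)
  qed
qed

section \<open>Pseudoconvexity and two-dimensional sections\<close>

theorem theorem1p1:
  fixes \<Omega> :: "(complex ^ 'n) set"
  assumes "open \<Omega>"
  shows "pseudoconvex \<Omega> \<longleftrightarrow>
    (\<forall>a b c. lin_indep_pair b c \<longrightarrow> pseudoconvex (plane_section \<Omega> a b c))"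
proof
  assume "pseudoconvex \<Omega>"
  then show "\<forall>a b c. lin_indep_pair b c \<longrightarrow> pseudoconvex (plane_section \<Omega> a b c)"
    by (simp add: pseudoconvex_plane_section)
next
  assume sec: "\<forall>a b c. lin_indep_pair b c \<longrightarrow> pseudoconvex (plane_section \<Omega> a b c)"
  show "pseudoconvex \<Omega>"
  proof (rule pseudoconvex_if_infdist_minimum[OF assms])
    fix d \<kappa>
    assume *: "\<Omega> \<noteq> UNIV" "analytic_disc \<Omega> d" "\<forall>z\<in>sphere 0 1. \<kappa> \<le> infdist (d z) (- \<Omega>)"
    show "\<forall>z\<in>cball 0 1. \<kappa> \<le> infdist (d z) (- \<Omega>)"
    proof (cases "CARD('n) = 1")
      case True
      then show ?thesis using infdist_minimum_principle_dim_1 assms * by blast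
    next
      case False
      then show ?thesis using infdist_minimum_principle[OF assms _ _ *] sec by blast
    qed
  qed
qed

end
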